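(* Let $(\epsilon,\omega)\in\{(0,0),(0,1),(1,0),(-1,0)\}\cup\{(1,\alpha_+):\alpha_+>0\}\cup\{(-1,\alpha_-):\alpha_->0\}$ and let $(\mathfrak g,\mathfrak h)$ be the Klein pair with $\mathfrak g=M\oplus H\oplus C\oplus\mathbf P\oplus\mathbf D\oplus\mathbf K\oplus\mathbf J$, $\mathfrak h=C\oplus\mathbf D\oplus\mathbf K\oplus\mathbf J$ and non-trivial commutators (besides those with $\mathbf J$) $$[\mathbf D,\mathbf K]=C,\quad [\mathbf K,H]=\mathbf P,\quad [\mathbf D,\mathbf P]=M,\quad [C,H]=M,\quad [H,M]=\epsilon\, C+\omega\, M,\quad [H,\mathbf P]=\epsilon\,\mathbf K+\omega\,\mathbf P.$$ Then $(\mathfrak g,\mathfrak h)$ is leibnizian for the metric structure $$\boldsymbol\xi=M,\qquad \boldsymbol\psi=-H^*,\qquad \boldsymbol\gamma=\mathbf P^*\otimes\mathbf P^* .$$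
   Context: Here $J_{ij}=-J_{ji}$ ($1\le i,j\le d$) span $\mathbf J\simeq\mathfrak{so}(d)$ with $[J_{ij},J_{kl}]=\delta_{jk}J_{il}-\delta_{jl}J_{ik}+\delta_{il}J_{jk}-\delta_{ik}J_{jl}$; $\mathbf P,\mathbf D,\mathbf K$ are spanned by $P_i,D_i,K_i$, each satisfying $[J_{ij},V_k]=-\delta_{ik}V_j+\delta_{jk}V_i$; $M,H,C$ are single generators commuting with $\mathbf J$. Shorthand: $[\mathbf D,\mathbf K]=C$ means $[D_i,K_j]=\delta_{ij}C$; $[\mathbf K,H]=\mathbf P$ means $[K_i,H]=P_i$; etc. A Klein pair is a Lie algebra $\mathfrak g$ with a subalgebra $\mathfrak h$. The adjoint action of $\mathfrak h$ on $\mathfrak g$ induces an action $\mathrm{ad}_{\mathfrak h}$ on $\mathfrak g/\mathfrak h$ and on its tensors. Here $\mathfrak g/\mathfrak h$ is identified with $\mathrm{Span}\{M,H,P_i\}$ with dual basis $M^*,H^*,P_i^*$, and $\mathbf P^*\otimes\mathbf P^*=\sum_iP_i^*\otimes P_i^*$ (restricted to $\ker\boldsymbol\psi$). The pair is leibnizian for $(\boldsymbol\xi,\boldsymbol\psi,\boldsymbol\gamma)$ if: $\boldsymbol\xi\in\mathfrak g/\mathfrak h$ is a non-zero $\mathrm{ad}_{\mathfrak h}$-invariant vector; $\boldsymbol\psi\in(\mathfrak g/\mathfrak h)^*$ is a non-zero $\mathrm{ad}_{\mathfrak h}$-invariant linear form with $\boldsymbol\psi(\boldsymbol\xi)=0$;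 $\boldsymbol\gamma$ is a symmetric, positive semi-definite, $\mathrm{ad}_{\mathfrak h}$-invariant bilinear form on $\ker\boldsymbol\psi$ whose radical is spanned by $\boldsymbol\xi$. *)

theory Defs
  imports "HOL-Analysis.Analysis"
begin

text \<open>
  The type \<open>'g\<close> is the underlying real vector space of the Lie algebra; the bracket is a
  function \<open>br\<close>.
\<close>

definition lie_algebra :: "('g::real_vector \<Rightarrow> 'g \<Rightarrow> 'g) \<Rightarrow> bool" where
  "lie_algebra br \<longleftrightarrow>
     bilinear br \<and> (\<forall>x. br x x = 0) \<and>
     (\<forall>x y z. br x (br y z) + br y (br z x) + br z (br x y) = 0)"

definition lie_subalgebra :: "('g::real_vector \<Rightarrow> 'g \<Rightarrow> 'g) \<Rightarrow> 'g set \<Rightarrow> bool" where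
  "lie_subalgebra br h \<longleftrightarrow> subspace h \<and> (\<forall>x\<in>h. \<forall>y\<in>h. br x y \<in> h)"

definition klein_pair :: "('g::real_vector \<Rightarrow> 'g \<Rightarrow> 'g) \<Rightarrow> 'g set \<Rightarrow> bool" where
  "klein_pair br h \<longleftrightarrow> lie_algebra br \<and> lie_subalgebra br h"

text \<open>
  Elements of the quotient are cosets. The operations are unions over all representatives, hence
  independent of choices by definition; the lemmas below show that they are the usual ones when
  \<open>h\<close> is a subspace (resp. a subalgebra). The zero vector of the quotient is \<open>coset h 0\<close>.
\<close>

definition coset :: "'g::real_vector set \<Rightarrow> 'g \<Rightarrow> 'g set" where
  "coset h x = {x + y |y. y \<in> h}"

definition quot :: "'g::real_vector set \<Rightarrow> 'g set set" where
  "quot h = range (coset h)"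

definition qadd :: "'g::real_vector set \<Rightarrow> 'g set \<Rightarrow> 'g set \<Rightarrow> 'g set" where
  "qadd h A B = (\<Union>a\<in>A. \<Union>b\<in>B. coset h (a + b))"

definition qscale :: "'g::real_vector set \<Rightarrow> real \<Rightarrow> 'g set \<Rightarrow> 'g set" where
  "qscale h r A = (\<Union>a\<in>A. coset h (r *\<^sub>R a))"

definition ad_quot ::
  "('g::real_vector \<Rightarrow> 'g \<Rightarrow> 'g) \<Rightarrow> 'g set \<Rightarrow> 'g \<Rightarrow> 'g set \<Rightarrow> 'g set" where
  "ad_quot br h X A = (\<Union>a\<in>A. coset h (br X a))"

lemma coset_self: "subspace h \<Longrightarrow> x \<in> coset h x"
  unfolding coset_def using subspace_0 by force

lemma coset_eq_iff:
  assumes "subspace h"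
  shows "coset h x = coset h y \<longleftrightarrow> x - y \<in> h"
proof
  assume "coset h x = coset h y"
  then have "x \<in> coset h y" using coset_self[OF assms] by metis
  then show "x - y \<in> h" by (auto simp: coset_def)
next
  assume xy: "x - y \<in> h"
  have "coset h a \<subseteq> coset h b" if "a - b \<in> h" for a b
  proof
    fix z assume "z \<in> coset h a"
    then obtain u where u: "u \<in> h" "z = a + u" by (auto simp: coset_def)
    have "(a - b) + u \<in> h" using assms that u(1) by (rule subspace_add)
    moreover have "z = b + ((a - b) + u)" using u(2) by simp
    ultimately show "z \<in> coset h b" unfolding coset_def by blast
  qed
  moreover have "y - x \<in> h" using subspace_neg[OF assms xy] by simp
  ultimately show "coset h x = coset h y" using xy by blast
qed

lemma qadd_coset:
  assumes h: "subspace h"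
  shows "qadd h (coset h x) (coset h y) = coset h (x + y)"
proof -
  have "coset h (a + b) = coset h (x + y)" if "a \<in> coset h x" "b \<in> coset h y" for a b
  proof -
    from that obtain u v where "u \<in> h" "a = x + u" "v \<in> h" "b = y + v"
      by (auto simp: coset_def)
    then show ?thesis using subspace_add[OF h, of u v] by (simp add: coset_eq_iff[OF h])
  qed
  then show ?thesis unfolding qadd_def using coset_self[OF h] by blast
qed

lemma qscale_coset:
  assumes h: "subspace h"
  shows "qscale h r (coset h x) = coset h (r *\<^sub>R x)"
proof -
  have "coset h (r *\<^sub>R a) = coset h (r *\<^sub>R x)" if "a \<in> coset h x" for a
  proof -
    from that obtain u where "u \<in> h" "a = x + u" by (auto simp: coset_def)
    then show ?thesis using subspace_scale[OF h, of u r]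
      by (simp add: coset_eq_iff[OF h] scaleR_add_right)
  qed
  then show ?thesis unfolding qscale_def using coset_self[OF h] by blast
qed

lemma ad_quot_coset:
  assumes kp: "klein_pair br h" and X: "X \<in> h"
  shows "ad_quot br h X (coset h x) = coset h (br X x)"
proof -
  have h: "subspace h" and cl: "\<And>y. y \<in> h \<Longrightarrow> br X y \<in> h" and bl: "bilinear br"
    using kp X by (auto simp: klein_pair_def lie_algebra_def lie_subalgebra_def)
  have "coset h (br X a) = coset h (br X x)" if "a \<in> coset h x" for a
  proof -
    from that obtain u where "u \<in> h" "a = x + u" by (auto simp: coset_def)
    then show ?thesis using cl by (simp add: coset_eq_iff[OF h] bilinear_radd[OF bl])
  qed
  then show ?thesis unfolding ad_quot_def using coset_self[OF h] by blast
qed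

text \<open>
  Forms are functions on cosets; only their values on the quotient (resp. on the kernel of
  \<open>\<psi>\<close>) matter.
\<close>

definition quot_linear_form :: "'g::real_vector set \<Rightarrow> ('g set \<Rightarrow> real) \<Rightarrow> bool" where
  "quot_linear_form h \<psi> \<longleftrightarrow>
     (\<forall>A\<in>quot h. \<forall>B\<in>quot h. \<psi> (qadd h A B) = \<psi> A + \<psi> B) \<and>
     (\<forall>r. \<forall>A\<in>quot h. \<psi> (qscale h r A) = r * \<psi> A)"

definition quot_ker :: "'g::real_vector set \<Rightarrow> ('g set \<Rightarrow> real) \<Rightarrow> 'g set set" where
  "quot_ker h \<psi> = {A \<in> quot h. \<psi> A = 0}"

definition quot_bilinear_on ::
  "'g::real_vector set \<Rightarrow> 'g set set \<Rightarrow> ('g set \<Rightarrow> 'g set \<Rightarrow> real) \<Rightarrow> bool" where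
  "quot_bilinear_on h W \<gamma> \<longleftrightarrow>
     (\<forall>A\<in>W. \<forall>B\<in>W. \<forall>C\<in>W.
        \<gamma> (qadd h A B) C = \<gamma> A C + \<gamma> B C \<and> \<gamma> C (qadd h A B) = \<gamma> C A + \<gamma> C B) \<and>
     (\<forall>r. \<forall>A\<in>W. \<forall>B\<in>W.
        \<gamma> (qscale h r A) B = r * \<gamma> A B \<and> \<gamma> A (qscale h r B) = r * \<gamma> A B)"

definition radical_on :: "'g set set \<Rightarrow> ('g set \<Rightarrow> 'g set \<Rightarrow> real) \<Rightarrow> 'g set set" where
  "radical_on W \<gamma> = {A \<in> W. \<forall>B\<in>W. \<gamma> A B = 0}"

text \<open>
  An element \<open>X\<close> of \<open>h\<close> acts on a linear form by \<open>- \<psi> \<circ> ad X\<close> and on a bilinear form by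
  \<open>- \<gamma> (ad X A) B - \<gamma> A (ad X B)\<close>; invariance means that these vanish. The latter makes sense
  on the kernel of \<open>\<psi>\<close>, which is stable under the action because \<open>\<psi>\<close> is invariant.
\<close>

definition leibnizian ::
  "('g::real_vector \<Rightarrow> 'g \<Rightarrow> 'g) \<Rightarrow> 'g set \<Rightarrow>
   'g set \<Rightarrow> ('g set \<Rightarrow> real) \<Rightarrow> ('g set \<Rightarrow> 'g set \<Rightarrow> real) \<Rightarrow> bool" where
  "leibnizian br h \<xi> \<psi> \<gamma> \<longleftrightarrow>
     klein_pair br h \<and>
     (\<xi> \<in> quot h \<and> \<xi> \<noteq> coset h 0 \<and> (\<forall>X\<in>h. ad_quot br h X \<xi> = coset h 0)) \<and>
     (quot_linear_form h \<psi> \<and> (\<exists>A\<in>quot h. \<psi> A \<noteq> 0) \<and>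
      (\<forall>X\<in>h. \<forall>A\<in>quot h. \<psi> (ad_quot br h X A) = 0)) \<and>
     \<psi> \<xi> = 0 \<and>
     (quot_bilinear_on h (quot_ker h \<psi>) \<gamma> \<and>
      (\<forall>A\<in>quot_ker h \<psi>. \<forall>B\<in>quot_ker h \<psi>. \<gamma> A B = \<gamma> B A) \<and>
      (\<forall>A\<in>quot_ker h \<psi>. \<gamma> A A \<ge> 0) \<and>
      (\<forall>X\<in>h. \<forall>A\<in>quot_ker h \<psi>. \<forall>B\<in>quot_ker h \<psi>.
         \<gamma> (ad_quot br h X A) B + \<gamma> A (ad_quot br h X B) = 0) \<and>
      radical_on (quot_ker h \<psi>) \<gamma> = {qscale h r \<xi> |r. True})"

text \<open>Names of the basis vectors; \<open>GJ i j\<close> is used only for \<open>i < j\<close>.\<close>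

datatype gen = GM | GH | GC | GP nat | GD nat | GK nat | GJ nat nat

definition gens :: "nat \<Rightarrow> gen set" where
  "gens d = {GM, GH, GC} \<union> GP ` {1..d} \<union> GD ` {1..d} \<union> GK ` {1..d} \<union>
            {GJ i j |i j. 1 \<le> i \<and> i < j \<and> j \<le> d}"

definition kd :: "nat \<Rightarrow> nat \<Rightarrow> real" where
  "kd i j = (if i = j then 1 else 0)"

text \<open>
  The vectors \<open>M\<close>, \<open>H\<close>, \<open>C\<close>, \<open>P i\<close>, \<open>D i\<close>, \<open>K i\<close> (\<open>1 \<le> i \<le> d\<close>) and \<open>J i j\<close>
  (\<open>1 \<le> i < j \<le> d\<close>) are distinct and form a basis of the whole space, and \<open>br\<close> is the
  alternating bilinear map with the given commutators. The Jacobi identity is not assumed here; it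
  is part of \<open>klein_pair\<close>.
\<close>

locale kinematical_algebra =
  fixes d :: nat
    and \<epsilon> \<omega> :: real
    and br :: "'g::real_vector \<Rightarrow> 'g \<Rightarrow> 'g"
    and M H C :: 'g
    and P D K :: "nat \<Rightarrow> 'g"
    and J :: "nat \<Rightarrow> nat \<Rightarrow> 'g"
  fixes e :: "gen \<Rightarrow> 'g"
  defines "e \<equiv> case_gen M H C P D K J"
  assumes d_pos: "1 \<le> d"
    and basis_inj: "inj_on e (gens d)"
    and basis_independent: "independent (e ` gens d)"
    and basis_span: "span (e ` gens d) = UNIV"
    and J_antisym: "\<And>i j. \<lbrakk>i \<in> {1..d}; j \<in> {1..d}\<rbrakk> \<Longrightarrow> J i j = - J j i"
    and br_bilinear: "bilinear br"
    and br_alternating: "\<And>x. br x x = 0"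
    and br_JJ: "\<And>i j k l. \<lbrakk>i \<in> {1..d}; j \<in> {1..d}; k \<in> {1..d}; l \<in> {1..d}\<rbrakk> \<Longrightarrow>
      br (J i j) (J k l) =
        kd j k *\<^sub>R J i l - kd j l *\<^sub>R J i k + kd i l *\<^sub>R J j k - kd i k *\<^sub>R J j l"
    and br_JV: "\<And>V i j k. \<lbrakk>V \<in> {P, D, K}; i \<in> {1..d}; j \<in> {1..d}; k \<in> {1..d}\<rbrakk> \<Longrightarrow>
      br (J i j) (V k) = - (kd i k *\<^sub>R V j) + kd j k *\<^sub>R V i"
    and br_J_scalar: "\<And>S i j. \<lbrakk>S \<in> {M, H, C}; i \<in> {1..d}; j \<in> {1..d}\<rbrakk> \<Longrightarrow>
      br (J i j) S = 0"
    and br_DK: "\<And>i j. \<lbrakk>i \<in> {1..d}; j \<in> {1..d}\<rbrakk> \<Longrightarrow> br (D i) (K j) = kd i j *\<^sub>R C"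
    and br_KH: "\<And>i. i \<in> {1..d} \<Longrightarrow> br (K i) H = P i"
    and br_DP: "\<And>i j. \<lbrakk>i \<in> {1..d}; j \<in> {1..d}\<rbrakk> \<Longrightarrow> br (D i) (P j) = kd i j *\<^sub>R M"
    and br_CH: "br C H = M"
    and br_HM: "br H M = \<epsilon> *\<^sub>R C + \<omega> *\<^sub>R M"
    and br_HP: "\<And>i. i \<in> {1..d} \<Longrightarrow> br H (P i) = \<epsilon> *\<^sub>R K i + \<omega> *\<^sub>R P i"
    and br_MC: "br M C = 0"
    and br_MV: "\<And>V i. \<lbrakk>V \<in> {P, D, K}; i \<in> {1..d}\<rbrakk> \<Longrightarrow> br M (V i) = 0"
    and br_CV: "\<And>V i. \<lbrakk>V \<in> {P, D, K}; i \<in> {1..d}\<rbrakk> \<Longrightarrow> br C (V i) = 0"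
    and br_HD: "\<And>i. i \<in> {1..d} \<Longrightarrow> br H (D i) = 0"
    and br_VV: "\<And>V i j. \<lbrakk>V \<in> {P, D, K}; i \<in> {1..d}; j \<in> {1..d}\<rbrakk> \<Longrightarrow> br (V i) (V j) = 0"
    and br_PK: "\<And>i j. \<lbrakk>i \<in> {1..d}; j \<in> {1..d}\<rbrakk> \<Longrightarrow> br (P i) (K j) = 0"

definition isotropy ::
  "nat \<Rightarrow> 'g::real_vector \<Rightarrow> (nat \<Rightarrow> 'g) \<Rightarrow> (nat \<Rightarrow> 'g) \<Rightarrow> (nat \<Rightarrow> nat \<Rightarrow> 'g) \<Rightarrow> 'g set" where
  "isotropy d C D K J =
     span ({C} \<union> D ` {1..d} \<union> K ` {1..d} \<union> {J i j |i j. i \<in> {1..d} \<and> j \<in> {1..d}})"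

text \<open>
  When the span of the independent set \<open>B\<close> is a complement of the subalgebra, it is identified with the
  quotient; \<open>dual_form B b\<close> is the element of the dual basis of \<open>B\<close> corresponding to \<open>b\<close>,
  viewed as a form on the quotient.
\<close>

definition dual_form :: "'g::real_vector set \<Rightarrow> 'g \<Rightarrow> 'g set \<Rightarrow> real" where
  "dual_form B b A = representation B (THE v. v \<in> A \<and> v \<in> span B) b"

end

theory Submission
  imports Defs
begin

text \<open>
  By trilinearity the Jacobi identity only has to be checked on the basis. The coordinates along
  \<open>M\<close>, \<open>H\<close> and \<open>P i\<close> with respect to the full basis vanish exactly on \<open>h\<close>, so they descend to the
  quotient and are the dual basis there. In the quotient, \<open>C\<close> and \<open>D i\<close> only produce multiples of
  \<open>M\<close>, \<open>K i\<close> maps \<open>H\<close> to \<open>P i\<close> and kills the rest, and \<open>J i j\<close> acts on the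
  \<open>P\<close>-coordinates by an infinitesimal rotation; hence \<open>H\<^sup>*\<close> is invariant and the Euclidean form
  is invariant where \<open>H\<^sup>*\<close> vanishes.
\<close>

section \<open>Dual forms of a complement as coordinates on the quotient\<close>

text \<open>In the decomposition \<open>x = v + w\<close> along the two spans, \<open>v\<close> is
  the only representative of the coset lying in \<open>span B\<close>, and \<open>w\<close> has no
  coordinates along \<open>B\<close>.\<close>

lemma dual_form_coset:
  assumes ind: "independent (B \<union> S)" and disj: "B \<inter> S = {}"
    and spn: "span (B \<union> S) = UNIV" and b: "b \<in> B"
  shows "dual_form B b (coset (span S) x) = representation (B \<union> S) x b"
proof -
  have indB: "independent B" using ind independent_mono by blast
  have repB: "representation (B \<union> S) v = representation B v" if "v \<in> span B" for v
    using representation_extend[OF ind that] by simp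
  have repS: "representation (B \<union> S) w c = 0" if "w \<in> span S" "c \<in> B" for w c
  proof -
    have "representation (B \<union> S) w = representation S w"
      using representation_extend[OF ind that(1)] by simp
    moreover have "c \<notin> S" using that(2) disj by auto
    ultimately show ?thesis using representation_ne_zero by metis
  qed
  have add: "representation (B \<union> S) (v + w) c =
    representation (B \<union> S) v c + representation (B \<union> S) w c" for v w c
    by (simp add: representation_add[OF ind] spn)
  obtain v w where v: "v \<in> span B" and w: "w \<in> span S" and x: "x = v + w"
    using span_Un[of B S] unfolding spn by blast
  have "(THE v. v \<in> coset (span S) x \<and> v \<in> span B) = v"
  proof (rule the_equality)
    have "v = x + (- w)" "- w \<in> span S" using x w by (auto intro: span_neg)
    then show "v \<in> coset (span S) x \<and> v \<in> span B" using v unfolding coset_def by blast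
  next
    fix v' assume v': "v' \<in> coset (span S) x \<and> v' \<in> span B"
    then obtain u where u: "u \<in> span S" "v' = x + u" by (auto simp: coset_def)
    \<comment> \<open>The difference lies in both spans: membership in \<open>span S\<close> kills
      its coordinates along \<open>B\<close>, and membership in \<open>span B\<close> leaves no
      others.\<close>
    have d: "v' - v \<in> span B" using v v' by (simp add: span_diff)
    have "v' - v \<in> span S" using u w x by (simp add: span_add)
    then have "representation B (v' - v) c = 0" for c
      using repS repB[OF d] representation_ne_zero by metis
    then show "v' = v" using sum_nonzero_representation_eq[OF indB d] by simp
  qed
  then show ?thesis using repB[OF v] repS[OF w b] add x by (simp add: dual_form_def)
qed

lemma kd_commute: "kd i j = kd j i"
  by (simp add: kd_def)

lemma kd_sum: "i \<in> {1..d} \<Longrightarrow> (\<Sum>k = 1..d. kd i k * f k) = f i"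
  by (simp add: kd_def if_distrib[where f = "\<lambda>x. x * _"] cong: if_cong)

section \<open>Coordinates and the bracket table\<close>

context kinematical_algebra
begin

text \<open>Indexed by names instead of vectors, so that distinctness of basis vectors becomes
  distinctness of constructors.\<close>

definition cf :: "gen \<Rightarrow> 'g \<Rightarrow> real" where
  "cf g x = representation (e ` gens d) x (e g)"

lemma linear_cf: "linear (cf g)"
  unfolding cf_def
  using representation_add[OF basis_independent] representation_scale[OF basis_independent]
  by (intro linearI) (auto simp: basis_span)

lemma cf_e: "g' \<in> gens d \<Longrightarrow> g \<in> gens d \<Longrightarrow> cf g (e g') = (if g = g' then 1 else 0)"
  using inj_onD[OF basis_inj] unfolding cf_def
  by (subst representation_basis[OF basis_independent]) auto

lemma J_refl: "i \<in> {1..d} \<Longrightarrow> J i i = 0"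
  using J_antisym[of i i] by (simp add: eq_neg_iff_add_eq_0 flip: scaleR_2)

text \<open>The condition \<open>i < j\<close> on the names \<open>GJ i j\<close> is dropped on
  purpose: the bracket table holds for all index pairs.\<close>

lemma gens_cases:
  assumes "x \<in> e ` gens d"
  obtains "x = M" | "x = H" | "x = C"
    | i where "i \<in> {1..d}" "x = P i" | i where "i \<in> {1..d}" "x = D i"
    | i where "i \<in> {1..d}" "x = K i"
    | i j where "i \<in> {1..d}" "j \<in> {1..d}" "x = J i j"
proof -
  from assms obtain g where g: "g \<in> gens d" "x = e g" by blast
  show ?thesis
  proof (cases g)
    case (GJ i j)
    then show ?thesis using g that(7)[of i j] by (simp add: gens_def e_def image_iff)
  qed (use g that in \<open>auto simp: gens_def e_def\<close>)
qed

lemma br_anti: "br x y = - br y x"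
proof -
  have "br x y + br y x = br (x + y) (x + y)"
    by (simp add: bilinear_ladd[OF br_bilinear] bilinear_radd[OF br_bilinear]
        br_alternating[of x] br_alternating[of y])
  then show ?thesis by (simp add: eq_neg_iff_add_eq_0 br_alternating)
qed

lemmas br_lin =
  bilinear_ladd[OF br_bilinear] bilinear_radd[OF br_bilinear]
  bilinear_lsub[OF br_bilinear] bilinear_rsub[OF br_bilinear]
  bilinear_lmul[OF br_bilinear] bilinear_rmul[OF br_bilinear]
  bilinear_lneg[OF br_bilinear] bilinear_rneg[OF br_bilinear]
  bilinear_lzero[OF br_bilinear] bilinear_rzero[OF br_bilinear]

lemmas br_table_upper =
  br_alternating br_JJ
  br_JV[of P, simplified] br_JV[of D, simplified] br_JV[of K, simplified]
  br_J_scalar[of M, simplified] br_J_scalar[of H, simplified] br_J_scalar[of C, simplified]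
  br_DK br_KH br_DP br_CH br_HM br_HP br_MC
  br_MV[of P, simplified] br_MV[of D, simplified] br_MV[of K, simplified]
  br_CV[of P, simplified] br_CV[of D, simplified] br_CV[of K, simplified] br_HD
  br_VV[of P, simplified] br_VV[of D, simplified] br_VV[of K, simplified] br_PK

text \<open>Antisymmetry is instantiated only at the orders that the given table lacks; as a general
  rewrite rule it would swap arguments forever.\<close>

lemmas br_table_lower =
  br_anti[of "P k" "J i j" for i j k] br_anti[of "D k" "J i j" for i j k]
  br_anti[of "K k" "J i j" for i j k] br_anti[of "M" "J i j" for i j]
  br_anti[of "H" "J i j" for i j] br_anti[of "C" "J i j" for i j]
  br_anti[of "K j" "D i" for i j] br_anti[of "H" "K i" for i]
  br_anti[of "P j" "D i" for i j] br_anti[of "H" "C"]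
  br_anti[of "M" "H"] br_anti[of "P i" "H" for i]
  br_anti[of "C" "M"] br_anti[of "P i" "M" for i]
  br_anti[of "D i" "M" for i] br_anti[of "K i" "M" for i]
  br_anti[of "P i" "C" for i] br_anti[of "D i" "C" for i]
  br_anti[of "K i" "C" for i] br_anti[of "D i" "H" for i]
  br_anti[of "K j" "P i" for i j]

lemmas br_table = br_table_upper br_table_lower

section \<open>Jacobi identity\<close>

text \<open>Treated separately because antisymmetry of \<open>J\<close> enters here; all other basis
  triples follow from the bracket table and bilinearity.\<close>

lemma jacobi_JJJ:
  assumes "i \<in> {1..d}" "j \<in> {1..d}" "k \<in> {1..d}" "l \<in> {1..d}" "m \<in> {1..d}" "n \<in> {1..d}"
  shows "br (J i j) (br (J k l) (J m n)) + br (J k l) (br (J m n) (J i j))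
    + br (J m n) (br (J i j) (J k l)) = 0"
proof -
  \<comment> \<open>Orients every \<open>J\<close> so that the summands cancel syntactically.\<close>
  have *: "J k i = - J i k" "J l i = - J i l" "J m i = - J i m" "J n i = - J i n"
    "J k j = - J j k" "J l j = - J j l" "J m j = - J j m" "J n j = - J j n"
    "J m k = - J k m" "J n k = - J k n" "J m l = - J l m" "J n l = - J l n"
    using assms J_antisym by blast+
  show ?thesis
    using assms by (simp add: br_table br_lin * kd_commute algebra_simps)
qed

text \<open>Seven kinds of basis vectors give 343 triples, each a direct computation with the
  table.\<close>

lemma jacobi_basis:
  assumes "x \<in> e ` gens d" "y \<in> e ` gens d" "z \<in> e ` gens d"
  shows "br x (br y z) + br y (br z x) + br z (br x y) = 0"
  by (rule gens_cases[OF assms(1)]; rule gens_cases[OF assms(2)]; rule gens_cases[OF assms(3)];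
      hypsubst; (simp only: jacobi_JJJ; fail)?;
      simp add: br_table br_lin kd_commute algebra_simps)

lemma jacobi: "br x (br y z) + br y (br z x) + br z (br x y) = 0"
proof -
  let ?j = "\<lambda>x y z. br x (br y z) + br y (br z x) + br z (br x y)"
  have lin: "linear (\<lambda>x. ?j x y z)" "linear (\<lambda>y. ?j x y z)" "linear (\<lambda>z. ?j x y z)" for x y z
    by (rule linearI; simp add: br_lin algebra_simps)+
  have 0: "f v = 0" if "linear f" "\<And>b. b \<in> e ` gens d \<Longrightarrow> f b = 0" for f :: "'g \<Rightarrow> 'g" and v
    using linear_eq_0_on_span[OF that] basis_span by auto
  \<comment> \<open>The arguments are released from the basis one at a time: first \<open>z\<close>,
    then \<open>y\<close>, then \<open>x\<close>.\<close>
  have "?j x y z = 0" if "x \<in> e ` gens d" "y \<in> e ` gens d" for x y z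
    using 0[OF lin(3)] jacobi_basis that by blast
  then have "?j x y z = 0" if "x \<in> e ` gens d" for x y z
    using 0[OF lin(2)] that by blast
  then show ?thesis using 0[OF lin(1)] by blast
qed

lemma lie_algebra: "lie_algebra br"
  unfolding lie_algebra_def using br_bilinear br_alternating jacobi by blast

section \<open>The isotropy subalgebra and the quotient in coordinates\<close>

abbreviation B :: "'g set" where "B \<equiv> {M, H} \<union> P ` {1..d}"
abbreviation h :: "'g set" where "h \<equiv> isotropy d C D K J"

definition quot_gens :: "gen set" where
  "quot_gens = {GM, GH} \<union> GP ` {1..d}"

lemma mem_quot_gens [simp]:
  "GM \<in> quot_gens" "GH \<in> quot_gens" "GP i \<in> quot_gens \<longleftrightarrow> i \<in> {1..d}"
  by (auto simp: quot_gens_def)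

lemma quot_gens_subset: "quot_gens \<subseteq> gens d"
  by (auto simp: quot_gens_def gens_def)

lemma B_eq: "B = e ` quot_gens"
  by (auto simp: quot_gens_def e_def image_Un image_image)

lemma isotropy_C: "C \<in> h"
  unfolding isotropy_def by (simp add: span_base)

lemma isotropy_base:
  assumes "i \<in> {1..d}"
  shows "D i \<in> h" "K i \<in> h" "j \<in> {1..d} \<Longrightarrow> J i j \<in> h"
  using assms unfolding isotropy_def by (auto intro!: span_base)

text \<open>The definition of \<open>h\<close> uses all \<open>J i j\<close>, the basis only those
  with \<open>i < j\<close>; antisymmetry and \<open>J i i = 0\<close> bridge the gap. Thus
  \<open>h\<close> is spanned by the basis vectors outside \<open>B\<close>.\<close>

lemma isotropy_eq: "h = span (e ` (gens d - quot_gens))"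
proof
  let ?S = "span (e ` (gens d - quot_gens))"
  have base: "e g \<in> ?S" if "g \<in> gens d" "g \<notin> quot_gens" for g
    using that by (auto intro: span_base)
  have J: "J i j \<in> ?S" if "i < j" "i \<in> {1..d}" "j \<in> {1..d}" for i j
    using base[of "GJ i j"] that by (auto simp: e_def gens_def quot_gens_def)
  have "J i j \<in> ?S" if ij: "i \<in> {1..d}" "j \<in> {1..d}" for i j
  proof (cases i j rule: linorder_cases)
    case greater
    then show ?thesis using J[of j i] J_antisym[OF ij] ij span_neg by metis
  qed (use J J_refl ij span_zero in auto)
  moreover have "C \<in> ?S" using base[of GC] by (auto simp: e_def gens_def quot_gens_def)
  moreover have "D i \<in> ?S" if "i \<in> {1..d}" for i
    using base[of "GD i"] that by (auto simp: e_def gens_def quot_gens_def)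
  moreover have "K i \<in> ?S" if "i \<in> {1..d}" for i
    using base[of "GK i"] that by (auto simp: e_def gens_def quot_gens_def)
  ultimately show "h \<subseteq> ?S"
    unfolding isotropy_def by (intro span_minimal) (auto simp: subspace_span)
  have "e g \<in> h" if "g \<in> gens d - quot_gens" for g
    using that
    by (cases g) (auto simp: gens_def quot_gens_def e_def isotropy_C isotropy_base)
  then show "?S \<subseteq> h"
    by (intro span_minimal) (auto simp: isotropy_def subspace_span)
qed

lemma subspace_h: "subspace h"
  by (simp add: isotropy_def subspace_span)

text \<open>The full basis splits into \<open>B\<close> and a basis of \<open>h\<close>, so forms on
  cosets can be computed on any representative.\<close>

lemma dual_form_cf:
  assumes "g \<in> quot_gens"
  shows "dual_form B (e g) (coset h x) = cf g x"
proof -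
  let ?S = "e ` (gens d - quot_gens)"
  have un: "B \<union> ?S = e ` gens d"
    by (simp only: B_eq image_Un[symmetric] Un_Diff_cancel Un_absorb1[OF quot_gens_subset])
  have disj: "B \<inter> ?S = {}"
    using inj_on_image_Int[OF basis_inj, of quot_gens "gens d - quot_gens"] quot_gens_subset
    unfolding B_eq by auto
  have ind: "independent (B \<union> ?S)" and spn: "span (B \<union> ?S) = UNIV"
    unfolding un by (rule basis_independent basis_span)+
  have "e g \<in> B" using assms unfolding B_eq by blast
  from dual_form_coset[OF ind disj spn this]
  have "dual_form B (e g) (coset (span ?S) x) = representation (B \<union> ?S) x (e g)" .
  then show ?thesis by (simp only: isotropy_eq un cf_def)
qed

text \<open>If the coordinates along \<open>B\<close> vanish, the basis expansion of
  \<open>x\<close> involves only vectors of \<open>h\<close>. This turns equality of cosets into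
  equality of coordinates.\<close>

lemma mem_h_iff: "x \<in> h \<longleftrightarrow> (\<forall>g\<in>quot_gens. cf g x = 0)"
proof
  have "cf g y = 0" if "g \<in> quot_gens" "y \<in> e ` (gens d - quot_gens)" for g y
    using that quot_gens_subset by (auto simp: cf_e)
  then show "x \<in> h \<Longrightarrow> \<forall>g\<in>quot_gens. cf g x = 0"
    unfolding isotropy_eq using linear_eq_0_on_span[OF linear_cf] by blast
next
  assume z: "\<forall>g\<in>quot_gens. cf g x = 0"
  let ?r = "representation (e ` gens d) x"
  have "b \<in> h" if nz: "?r b \<noteq> 0" for b
  proof -
    obtain g where "b = e g" "g \<in> gens d" using representation_ne_zero[OF nz] by auto
    then show ?thesis using z nz unfolding isotropy_eq cf_def by (auto intro!: span_base)
  qed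
  then have "(\<Sum>b | ?r b \<noteq> 0. ?r b *\<^sub>R b) \<in> h"
    using subspace_h by (auto intro!: subspace_sum subspace_scale)
  then show "x \<in> h"
    using sum_nonzero_representation_eq[OF basis_independent] basis_span by simp
qed

lemma cf_values:
  "g \<in> quot_gens \<Longrightarrow> cf g M = (if g = GM then 1 else 0)"
  "g \<in> quot_gens \<Longrightarrow> cf g H = (if g = GH then 1 else 0)"
  "g \<in> quot_gens \<Longrightarrow> i \<in> {1..d} \<Longrightarrow> cf g (P i) = (if g = GP i then 1 else 0)"
  using cf_e[of GM g] cf_e[of GH g] cf_e[of "GP i" g] subsetD[OF quot_gens_subset, of g]
    subsetD[OF quot_gens_subset, of GM] subsetD[OF quot_gens_subset, of GH]
    subsetD[OF quot_gens_subset, of "GP i"]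
  by (simp_all add: e_def)

lemma cf_isotropy:
  assumes "g \<in> quot_gens" "i \<in> {1..d}"
  shows "cf g (D i) = 0" "cf g (K i) = 0" "j \<in> {1..d} \<Longrightarrow> cf g (J i j) = 0"
  using assms isotropy_base mem_h_iff by blast+

lemma cf_C: "g \<in> quot_gens \<Longrightarrow> cf g C = 0"
  using isotropy_C mem_h_iff by blast

lemmas cf_lin =
  linear_add[OF linear_cf] linear_diff[OF linear_cf] linear_neg[OF linear_cf]
  linear_scale[OF linear_cf] linear_0[OF linear_cf]

lemmas cf_simps = cf_values cf_isotropy cf_C cf_lin

section \<open>Action of the isotropy subalgebra on coordinates\<close>

text \<open>Closure and invariance are linear conditions on the element of \<open>h\<close>, so they
  can be checked on generators.\<close>

lemma isotropy_induct [consumes 1, case_names subspace C D K J]: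
  assumes "X \<in> h" "subspace {X. Q X}" "Q C"
    and "\<And>i. i \<in> {1..d} \<Longrightarrow> Q (D i)" "\<And>i. i \<in> {1..d} \<Longrightarrow> Q (K i)"
    and "\<And>i j. i \<in> {1..d} \<Longrightarrow> j \<in> {1..d} \<Longrightarrow> Q (J i j)"
  shows "Q X"
  using assms(1) unfolding isotropy_def
  by (rule span_induct[where P = Q]) (use assms(2-) in auto)

text \<open>Serves to compute the coordinates of \<open>br X x\<close> for a generator
  \<open>X\<close> as linear functions of \<open>x\<close>.\<close>

lemma linear_eq_on_basis:
  fixes f f' :: "'g \<Rightarrow> real"
  assumes "linear f" "linear f'" "f M = f' M" "f H = f' H" "f C = f' C"
    and "\<And>i. i \<in> {1..d} \<Longrightarrow> f (P i) = f' (P i)" "\<And>i. i \<in> {1..d} \<Longrightarrow> f (D i) = f' (D i)"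
    and "\<And>i. i \<in> {1..d} \<Longrightarrow> f (K i) = f' (K i)"
    and "\<And>i j. i \<in> {1..d} \<Longrightarrow> j \<in> {1..d} \<Longrightarrow> f (J i j) = f' (J i j)"
  shows "f x = f' x"
proof -
  have "f b = f' b" if "b \<in> e ` gens d" for b
    using that by (rule gens_cases) (use assms(3-) in auto)
  then show ?thesis
    using linear_eq_on_span[OF assms(1,2)] basis_span by blast
qed

lemma linear_cf_br: "linear (\<lambda>x. cf g (br X x))"
  by (rule linearI) (simp_all add: br_lin cf_lin)

text \<open>Matches the right-hand side of \<open>cf_br_J_P\<close>, where the minus sign is
  therefore written as a negated coefficient.\<close>

lemma linear_cf_combination:
  "linear (\<lambda>x. a * cf g x + b * cf g' x)"
  by (rule linearI) (simp_all add: cf_lin algebra_simps)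

text \<open>The name \<open>GM\<close> is excluded because \<open>br C H = M\<close>; the other
  basis vectors are sent to 0.\<close>

lemma cf_br_C: "g \<in> quot_gens \<Longrightarrow> g \<noteq> GM \<Longrightarrow> cf g (br C x) = 0"
  by (rule linear_eq_on_basis[OF linear_cf_br, where f' = "\<lambda>_. 0"])
    (simp_all add: br_table cf_simps linear_zero)

text \<open>The name \<open>GM\<close> is excluded because \<open>br (D i) (P i) = M\<close>; all
  other brackets of \<open>D i\<close> with basis vectors lie in \<open>h\<close>.\<close>

lemma cf_br_D: "g \<in> quot_gens \<Longrightarrow> g \<noteq> GM \<Longrightarrow> i \<in> {1..d} \<Longrightarrow> cf g (br (D i) x) = 0"
  by (rule linear_eq_on_basis[OF linear_cf_br, where f' = "\<lambda>_. 0"])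
    (simp_all add: br_table cf_simps linear_zero)

text \<open>The only bracket of \<open>K i\<close> with a basis vector that leaves \<open>h\<close>
  is \<open>br (K i) H = P i\<close>, as for a Galilean boost.\<close>

lemma cf_br_K:
  assumes "i \<in> {1..d}" "g \<in> quot_gens"
  shows "cf g (br (K i) x) = (if g = GP i then cf GH x else 0)"
  by (cases "g = GP i"; rule linear_eq_on_basis[OF linear_cf_br])
    (use assms in \<open>simp_all add: br_table cf_simps linear_cf linear_zero kd_def\<close>)

lemma cf_br_J_H:
  assumes "i \<in> {1..d}" "j \<in> {1..d}"
  shows "cf GH (br (J i j) x) = 0"
  by (rule linear_eq_on_basis[OF linear_cf_br, where f' = "\<lambda>_. 0"])
    (use assms in \<open>simp_all add: br_table cf_simps linear_zero\<close>)

text \<open>An infinitesimal rotation in the plane of \<open>P i\<close> and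
  \<open>P j\<close>.\<close>

lemma cf_br_J_P:
  assumes "i \<in> {1..d}" "j \<in> {1..d}" "k \<in> {1..d}"
  shows "cf (GP k) (br (J i j) x) = kd i k * cf (GP j) x + (- kd j k) * cf (GP i) x"
  by (rule linear_eq_on_basis[OF linear_cf_br linear_cf_combination])
    (use assms in \<open>simp_all add: br_table cf_simps kd_def\<close>)

section \<open>Klein pair and invariance\<close>

text \<open>The bracket vanishes in the algebra itself, not merely modulo \<open>h\<close>.\<close>

lemma br_isotropy_M: "X \<in> h \<Longrightarrow> br X M = 0"
  by (induction rule: isotropy_induct) (auto simp: subspace_def br_lin br_table)

lemma br_isotropy_closed:
  assumes X: "X \<in> h" and Y: "Y \<in> h"
  shows "br X Y \<in> h"
proof -
  \<comment> \<open>Closure is a linear condition in each argument, which permits an induction on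
    \<open>X\<close> followed by one on \<open>Y\<close>.\<close>
  have sub: "subspace {Y. br X Y \<in> h}" "subspace {X. br X Y \<in> h}" for X Y
    using subspace_h by (auto simp: subspace_def br_lin)
  note cl = isotropy_C isotropy_base subspace_add[OF subspace_h] subspace_diff[OF subspace_h]
    subspace_scale[OF subspace_h] subspace_neg[OF subspace_h] subspace_0[OF subspace_h]
  from X show ?thesis
  proof (induction rule: isotropy_induct)
    case C
    from Y show ?case
      by (induction rule: isotropy_induct) (auto simp: sub br_table intro!: cl)
  next
    case (D i)
    from Y show ?case
      by (induction rule: isotropy_induct) (use D in \<open>auto simp: sub br_table intro!: cl\<close>)
  next
    case (K i)
    from Y show ?case
      by (induction rule: isotropy_induct) (use K in \<open>auto simp: sub br_table intro!: cl\<close>)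
  next
    case (J i j)
    from Y show ?case
      by (induction rule: isotropy_induct) (use J in \<open>auto simp: sub br_table intro!: cl\<close>)
  qed (rule sub)
qed

lemma klein_pair: "klein_pair br h"
  unfolding klein_pair_def lie_subalgebra_def
  using lie_algebra subspace_h br_isotropy_closed by blast

lemma clock_invariant: "X \<in> h \<Longrightarrow> cf GH (br X x) = 0"
  by (induction rule: isotropy_induct)
    (auto simp: subspace_def br_lin cf_lin cf_br_C cf_br_D cf_br_K cf_br_J_H)

text \<open>Rotations act skew-symmetrically on the \<open>P\<close>-coordinates, \<open>C\<close>
  and \<open>D i\<close> leave no \<open>P\<close>-component, and \<open>K i\<close> contributes
  only multiples of the \<open>H\<close>-coordinates, which vanish on the kernel.\<close>

lemma metric_invariant:
  assumes "X \<in> h" and H0: "cf GH x = 0" "cf GH y = 0"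
  shows "(\<Sum>k = 1..d. cf (GP k) (br X x) * cf (GP k) y)
    + (\<Sum>k = 1..d. cf (GP k) x * cf (GP k) (br X y)) = 0"
    (is "?f X + ?g X = 0")
  using assms(1)
proof (induction rule: isotropy_induct)
  case subspace
  have "linear (\<lambda>X. ?f X + ?g X)"
    by (rule linearI)
      (simp_all add: br_lin cf_lin sum.distrib algebra_simps flip: sum_distrib_left)
  then show ?case by (rule linear_subspace_kernel)
next
  case (J i j)
  have "?f (J i j) = cf (GP j) x * (\<Sum>k = 1..d. kd i k * cf (GP k) y)
      - cf (GP i) x * (\<Sum>k = 1..d. kd j k * cf (GP k) y)"
    using J by (simp add: cf_br_J_P sum_subtractf sum_distrib_left algebra_simps)
  moreover have "?g (J i j) = cf (GP j) y * (\<Sum>k = 1..d. kd i k * cf (GP k) x)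
      - cf (GP i) y * (\<Sum>k = 1..d. kd j k * cf (GP k) x)"
    using J by (simp add: cf_br_J_P sum_subtractf sum_distrib_left algebra_simps)
  \<comment> \<open>With subscripts for the \<open>P\<close>-coordinates, the two sums collapse to
    \<open>x_j y_i - x_i y_j\<close> and \<open>y_j x_i - y_i x_j\<close>, which cancel.\<close>
  ultimately show ?case by (simp only: kd_sum[OF J(1)] kd_sum[OF J(2)]) simp
qed (use H0 in \<open>simp_all add: cf_br_C cf_br_D cf_br_K cong: if_cong\<close>)

section \<open>The metric structure\<close>

lemma leibnizian:
  "leibnizian br h (coset h M) (\<lambda>X. - dual_form B H X)
    (\<lambda>X Y. \<Sum>i = 1..d. dual_form B (P i) X * dual_form B (P i) Y)"
proof -
  define \<delta> where "\<delta> = dual_form B"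
  have dH: "\<delta> H (coset h x) = cf GH x" for x
    using dual_form_cf[of GH x] by (simp add: e_def \<delta>_def)
  have dP: "\<delta> (P i) (coset h x) = cf (GP i) x" if "i \<in> {1..d}" for i x
    using dual_form_cf[of "GP i" x] that by (simp add: e_def \<delta>_def)
  define \<gamma> where "\<gamma> X Y = (\<Sum>i = 1..d. \<delta> (P i) X * \<delta> (P i) Y)" for X Y
  have g: "\<gamma> (coset h x) (coset h y) = (\<Sum>i = 1..d. cf (GP i) x * cf (GP i) y)" for x y
    unfolding \<gamma>_def by (intro sum.cong) (simp_all only: dP)
  have ker: "quot_ker h (\<lambda>X. - \<delta> H X) = {coset h x |x. cf GH x = 0}"
    unfolding quot_ker_def quot_def by (auto simp: dH)
  note ops = qadd_coset[OF subspace_h] qscale_coset[OF subspace_h] ad_quot_coset[OF klein_pair]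
  have eq: "coset h x = coset h y \<longleftrightarrow> (\<forall>g\<in>quot_gens. cf g x = cf g y)" for x y
    by (simp add: coset_eq_iff[OF subspace_h] mem_h_iff cf_lin)
  have rad: "radical_on {coset h x |x. cf GH x = 0} \<gamma> = {qscale h r (coset h M) |r. True}"
    (is "?R = ?L")
  proof
    show "?R \<subseteq> ?L"
    proof
      fix A assume "A \<in> ?R"
      \<comment> \<open>An element of the radical is tested against itself: a vanishing sum of
        squares forces every \<open>P\<close>-coordinate to vanish.\<close>
      then obtain x where A: "A = coset h x" and x: "cf GH x = 0" "\<gamma> (coset h x) (coset h x) = 0"
        unfolding radical_on_def by blast
      have "cf (GP i) x = 0" if "i \<in> {1..d}" for i
        using x(2) that by (simp add: g sum_nonneg_eq_0_iff)
      \<comment> \<open>The \<open>H\<close>-coordinate is zero on the kernel, so only the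
        \<open>M\<close>-coordinate survives and gives the scalar factor.\<close>
      then have "coset h x = coset h (cf GM x *\<^sub>R M)"
        using x(1) by (auto simp: eq quot_gens_def cf_simps)
      then show "A \<in> ?L" using A ops(2) by auto
    qed
    show "?L \<subseteq> ?R"
      unfolding radical_on_def by (auto simp: ops g cf_simps)
  qed
  have bil: "quot_bilinear_on h {coset h x |x. cf GH x = 0} \<gamma>"
    unfolding quot_bilinear_on_def
    by (auto simp: ops g cf_lin sum.distrib sum_distrib_left algebra_simps)
  have inv: "\<gamma> (ad_quot br h X A) E + \<gamma> A (ad_quot br h X E) = 0"
    if "X \<in> h" "A \<in> {coset h x |x. cf GH x = 0}" "E \<in> {coset h x |x. cf GH x = 0}" for X A E
    using that metric_invariant by (auto simp: ops g)
  have form: "quot_linear_form h (\<lambda>X. - \<delta> H X)"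
    unfolding quot_linear_form_def quot_def by (auto simp: ops dH cf_lin)
  \<comment> \<open>The coset of \<open>H\<close> is a witness, with value -1.\<close>
  have "\<exists>A\<in>quot h. - \<delta> H A \<noteq> 0"
    unfolding quot_def by (auto simp: dH cf_values intro!: exI[of _ H])
  moreover have "coset h M \<noteq> coset h 0"
    by (auto simp: eq cf_simps intro!: bexI[of _ GM])
  moreover have "\<gamma> A E = \<gamma> E A" "\<gamma> A A \<ge> 0" for A E
    by (auto simp: \<gamma>_def mult.commute intro!: sum_nonneg)
  ultimately show ?thesis
    unfolding \<delta>_def[symmetric] \<gamma>_def[symmetric] leibnizian_def ker
    using klein_pair form bil rad inv
    by (auto simp: quot_def ops dH cf_values br_isotropy_M clock_invariant)
qed

end

theorem proposition6p6:
  fixes d :: nat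
    and \<epsilon> \<omega> :: real
    and br :: "'g::real_vector \<Rightarrow> 'g \<Rightarrow> 'g"
    and M H C :: 'g
    and P D K :: "nat \<Rightarrow> 'g"
    and J :: "nat \<Rightarrow> nat \<Rightarrow> 'g"
  assumes "(\<epsilon>, \<omega>) \<in> {(0, 0), (0, 1), (1, 0), (-1, 0)} \<union>
                    {(1, \<alpha>) |\<alpha>. \<alpha> > 0} \<union> {(-1, \<alpha>) |\<alpha>. \<alpha> > 0}"
    and "kinematical_algebra d \<epsilon> \<omega> br M H C P D K J"
  defines "B \<equiv> {M, H} \<union> P ` {1..d}"
    and "h \<equiv> isotropy d C D K J"
  shows "leibnizian br h
           (coset h M)
           (\<lambda>X. - dual_form B H X)
           (\<lambda>X Y. \<Sum>i = 1..d. dual_form B (P i) X * dual_form B (P i) Y)"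
  unfolding B_def h_def using assms(2) by (rule kinematical_algebra.leibnizian)

end
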